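(* There exist two $\mathbb{F}$-vector subspaces $F_1, F_2$ of $H(T,E)$, each dense in $H(T,E)$, such that $F_1 \subseteq U(T,E)\cup\{0\}$, $F_2 \subseteq U(T,E)\cup\{0\}$ and $F_1\cap F_2=\{0\}$.
   Context: Convention: $\mathbb{N}=\{1,2,3,\dots\}$. Tree. $T$ is the vertex set of a rooted tree with root $x_0$; $T_0=\{x_0\}$ and, for $n\in\mathbb{N}$, $T_n$ is the set of vertices at distance $n$ from $x_0$. For $x\in T$, $S(x)$ is the set of children of $x$. Each $T_n$ is finite and each $S(x)$ has at least two elements. For all $x\in T$, $y\in S(x)$ a real number $q(x,y)>0$ is given with $\sum_{y\in S(x)}q(x,y)=1$ for all $x \in T$. Boundary and measure. $\partial T$ is the set of all infinite geodesics starting at $x_0$, i.e. sets $e=\{z_n:n\in\mathbb{N}\}\subseteq T$ with $z_1=x_0$ and $z_{n+1}\in S(z_n)$ for all $n \in \mathbb{N}$. For $x\in T$, $B_x=\{e\in\partial T: x\in e\}$. For $x\in T_n$, $n\ge 1$, $p(B_x)=\prod_{j=0}^{n-1}q(y_j,y_{j+1})$, where $y_0=x_0$, $y_n=x$, $y_{j+1}\in S(y_j)$ for $0\le j\le n-1$. $\mathcal{M}_n$ is the $\sigma$-algebra on $\partial T$ generated by $\{B_x:x\in T_n\}$, and $\mathbb{P}_n$ is the probability measure on $\mathcal{M}_n$ extending $p$. $\mathbb{P}$ is the complete probability measure on $(\partial T,\mathcal{M})$ with $\mathbb{P}|_{\mathcal{M}_n}=\mathbb{P}_n$ for all $n$,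 where $\mathcal{M}$ is the completion of the $\sigma$-algebra generated by $\bigcup_{n\ge1}\mathcal{M}_n$ (it exists by Kolmogorov's consistency theorem). Values. $\mathbb{F}$ is a field endowed with a metric for which addition, multiplication and the inverse function are continuous. $E$ is a separable topological vector space over $\mathbb{F}$ (addition and scalar multiplication are continuous), metrizable by a translation invariant metric $d$. $L^0(\partial T,E)$ is the space of $\mathcal{M}$-measurable functions $\partial T\to E$ (preimages of open sets lie in $\mathcal{M}$), identified when equal $\mathbb{P}$-almost everywhere, with the topology of convergence in probability, induced by the metric $P(\psi,\phi)=\int_{\partial T}\frac{d(\psi(e),\phi(e))}{1+d(\psi(e),\phi(e))}\,d\mathbb{P}(e)$. Harmonic functions. For all $x\in T$, $y\in S(x)$ a scalar $w(x,y)\in\mathbb{F}\setminus\{0\}$ is fixed, with $\sum_{y\in S(x)}w(x,y)=1$ for all $x\in T$. A function $f:T\to E$ is (generalized) harmonic if $f(x)=\sum_{y\in S(x)}w(x,y)f(y)$ for all $x\in T$. $H(T,E)$ is the set of harmonic functions, with the topology of pointwise convergence on $T$ and pointwise vector space operations. For $f\in H(T,E)$, $n\in\mathbb{N}$, the $\mathcal{M}$-measurable function $\omega_n(f):\partial T\to E$ is given by $\omega_n(f)(e)=f(z)$, where $z$ is the unique element of $e\cap T_n$. Universal functions. $f\in H(T,E)$ is universal if the sequence $(\omega_n(f))_{n=1}^\infty$ is dense in $L^0(\partial T,E)$. $U(T,E)$ is the set of universal functions. *)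

theory Defs
  imports "HOL-Probability.Probability" "HOL-Library.Function_Algebras"
begin

(* Conventions.  The vertex set T is the whole type 'v, so a function on T is a function on 'v and
   pointwise convergence on T is the product topology that Function_Topology puts on 'v => 'e.
   The metrics on the field and on E are the "dist" of their types.
   The natural numbers of the source start at 1; where the index range matters, "n >= 1" is
   written out.  *)

definition graph_path :: "('v \<Rightarrow> 'v \<Rightarrow> bool) \<Rightarrow> 'v \<Rightarrow> 'v list \<Rightarrow> 'v \<Rightarrow> bool" where
  "graph_path adj x xs y \<longleftrightarrow>
     xs \<noteq> [] \<and> hd xs = x \<and> last xs = y \<and> distinct xs \<and> successively adj xs"

(* The "tree" of Graph_Theory.Digraph_Component only forbids directed cycles of a digraph, so it is
   not the notion of an undirected tree that is needed here. *)
definition graph_tree :: "('v \<Rightarrow> 'v \<Rightarrow> bool) \<Rightarrow> bool" where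
  "graph_tree adj \<longleftrightarrow> symp adj \<and> irreflp adj \<and> (\<forall>x y. \<exists>!xs. graph_path adj x xs y)"

definition graph_dist :: "('v \<Rightarrow> 'v \<Rightarrow> bool) \<Rightarrow> 'v \<Rightarrow> 'v \<Rightarrow> nat" where
  "graph_dist adj x y = (LEAST n. (adj ^^ n) x y)"

definition level :: "('v \<Rightarrow> 'v \<Rightarrow> bool) \<Rightarrow> 'v \<Rightarrow> nat \<Rightarrow> 'v set" where
  "level adj x0 n = {x. graph_dist adj x0 x = n}"

definition children :: "('v \<Rightarrow> 'v \<Rightarrow> bool) \<Rightarrow> 'v \<Rightarrow> 'v \<Rightarrow> 'v set" where
  "children adj x0 x = {y. adj x y \<and> graph_dist adj x0 y = Suc (graph_dist adj x0 x)}"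

(* Geodesics are sets of vertices; the enumeration z is indexed from 0, so that z n is in level n. *)
definition boundary :: "('v \<Rightarrow> 'v \<Rightarrow> bool) \<Rightarrow> 'v \<Rightarrow> 'v set set" where
  "boundary adj x0 =
     {e. \<exists>z::nat \<Rightarrow> 'v. z 0 = x0 \<and> (\<forall>n. z (Suc n) \<in> children adj x0 (z n)) \<and> e = range z}"

definition cylinder :: "('v \<Rightarrow> 'v \<Rightarrow> bool) \<Rightarrow> 'v \<Rightarrow> 'v \<Rightarrow> 'v set set" where
  "cylinder adj x0 x = {e \<in> boundary adj x0. x \<in> e}"

definition level_algebra :: "('v \<Rightarrow> 'v \<Rightarrow> bool) \<Rightarrow> 'v \<Rightarrow> nat \<Rightarrow> 'v set set set" where
  "level_algebra adj x0 n = sigma_sets (boundary adj x0) (cylinder adj x0 ` level adj x0 n)"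

(* The cylinders over level n generate level_algebra n, and they partition the boundary, so the
   second conjunct says that the restriction of Pr to level_algebra n is the probability measure
   on it that takes the prescribed values on those cylinders. *)
definition boundary_measure ::
  "('v \<Rightarrow> 'v \<Rightarrow> bool) \<Rightarrow> 'v \<Rightarrow> ('v \<Rightarrow> 'v \<Rightarrow> real) \<Rightarrow> 'v set measure \<Rightarrow> bool" where
  "boundary_measure adj x0 q Pr \<longleftrightarrow>
     (\<exists>N. prob_space N \<and> space N = boundary adj x0 \<and>
          sets N = sigma_sets (boundary adj x0) (\<Union>n\<in>{1..}. level_algebra adj x0 n) \<and>
          Pr = completion N) \<and>
     (\<forall>n\<ge>1. \<forall>y::nat \<Rightarrow> 'v. y 0 = x0 \<and> (\<forall>j<n. y (Suc j) \<in> children adj x0 (y j)) \<longrightarrow>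
          measure Pr (cylinder adj x0 (y n)) = (\<Prod>j<n. q (y j) (y (Suc j))))"

definition continuous_field_ops :: "'k::{field, metric_space} itself \<Rightarrow> bool" where
  "continuous_field_ops _ \<longleftrightarrow>
     continuous_on UNIV (\<lambda>(a::'k, b). a + b) \<and>
     continuous_on UNIV (\<lambda>(a::'k, b). a * b) \<and>
     continuous_on (UNIV - {0}) (inverse :: 'k \<Rightarrow> 'k)"

definition metric_tvs ::
  "('k::{field, metric_space} \<Rightarrow> 'e::{ab_group_add, metric_space} \<Rightarrow> 'e) \<Rightarrow> bool" where
  "metric_tvs smul \<longleftrightarrow>
     vector_space smul \<and>
     continuous_on UNIV (\<lambda>(u::'e, v). u + v) \<and>
     continuous_on UNIV (\<lambda>(a, v). smul a v) \<and>
     (\<forall>u v z::'e. dist (u + z) (v + z) = dist u v)"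

definition L0_dist :: "'a measure \<Rightarrow> ('a \<Rightarrow> 'e::metric_space) \<Rightarrow> ('a \<Rightarrow> 'e) \<Rightarrow> real" where
  "L0_dist M \<psi> \<phi> = (\<integral>e. dist (\<psi> e) (\<phi> e) / (1 + dist (\<psi> e) (\<phi> e)) \<partial>M)"

(* Points of L^0 are represented by measurable functions; L0_dist does not depend on the choice of
   a representative, so this is density of the set of classes in the metric space L^0. *)
definition dense_in_L0 :: "'a measure \<Rightarrow> ('a \<Rightarrow> 'e::metric_space) set \<Rightarrow> bool" where
  "dense_in_L0 M X \<longleftrightarrow>
     X \<subseteq> borel_measurable M \<and>
     (\<forall>\<phi>\<in>borel_measurable M. \<forall>\<epsilon>>0. \<exists>\<psi>\<in>X. L0_dist M \<psi> \<phi> < \<epsilon>)"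

definition harmonic_funs ::
  "('v \<Rightarrow> 'v \<Rightarrow> bool) \<Rightarrow> 'v \<Rightarrow> ('k \<Rightarrow> 'e \<Rightarrow> 'e::ab_group_add) \<Rightarrow> ('v \<Rightarrow> 'v \<Rightarrow> 'k)
     \<Rightarrow> ('v \<Rightarrow> 'e) set" where
  "harmonic_funs adj x0 smul w =
     {f. \<forall>x. f x = (\<Sum>y\<in>children adj x0 x. smul (w x y) (f y))}"

definition omega :: "('v \<Rightarrow> 'v \<Rightarrow> bool) \<Rightarrow> 'v \<Rightarrow> nat \<Rightarrow> ('v \<Rightarrow> 'e) \<Rightarrow> 'v set \<Rightarrow> 'e" where
  "omega adj x0 n f e = f (THE z. z \<in> e \<inter> level adj x0 n)"

definition universal_funs ::
  "('v \<Rightarrow> 'v \<Rightarrow> bool) \<Rightarrow> 'v \<Rightarrow> 'v set measure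
     \<Rightarrow> ('k \<Rightarrow> 'e \<Rightarrow> 'e::{ab_group_add, metric_space}) \<Rightarrow> ('v \<Rightarrow> 'v \<Rightarrow> 'k) \<Rightarrow> ('v \<Rightarrow> 'e) set" where
  "universal_funs adj x0 Pr smul w =
     {f \<in> harmonic_funs adj x0 smul w. dense_in_L0 Pr {omega adj x0 n f | n. n \<ge> 1}}"

definition pointwise_smul :: "('k \<Rightarrow> 'e \<Rightarrow> 'e) \<Rightarrow> 'k \<Rightarrow> ('v \<Rightarrow> 'e) \<Rightarrow> 'v \<Rightarrow> 'e" where
  "pointwise_smul smul c f = (\<lambda>x. smul c (f x))"

(* Addition and zero of functions are those of HOL-Library.Function_Algebras. *)
definition dense_subspace_of ::
  "('k::field \<Rightarrow> 'e \<Rightarrow> 'e::{ab_group_add, topological_space}) \<Rightarrow> ('v \<Rightarrow> 'e) set \<Rightarrow> ('v \<Rightarrow> 'e) set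
     \<Rightarrow> bool" where
  "dense_subspace_of smul F H \<longleftrightarrow>
     F \<subseteq> H \<and> module.subspace (pointwise_smul smul) F \<and> H \<subseteq> closure F"

end

theory Submission
  imports Defs
begin

text \<open>Mark in every vertex a child of conditional probability at most 1/2. A harmonic function can be
  given arbitrary values at the root and at the unmarked vertices; the value at the marked child is
  then solved for. If, between the levels \<open>n\<close> and \<open>n + k\<close>, the free values are constant along the
  edges, the function takes these constants on level \<open>n + k\<close>, except on the marked paths issuing from
  level \<open>n\<close>, which have total probability at most \<open>(1/2)^k\<close>. Hence one can build a sequence
  \<open>f l\<close> of harmonic functions such that for all \<open>i\<close> and \<open>j\<close> there are infinitely many levels on
  which, off small sets, \<open>f i\<close> equals the \<open>j\<close>-th element of a countable dense set of targets while
  every other \<open>f l\<close> with \<open>l\<close> below that level vanishes. A nontrivial linear combination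
  with coefficient \<open>a \<noteq> 0\<close> at \<open>f i\<close> thus approximates \<open>a\<close> times every target, so it is universal. The
  even-indexed and the odd-indexed members span the two subspaces, which meet only in 0 because a
  nontrivial combination of all members cannot vanish.\<close>

section \<open>Rooted trees\<close>

lemma successively_imp_relpowp:
  assumes "successively R xs" "xs \<noteq> []"
  shows "(R ^^ (length xs - 1)) (hd xs) (last xs)"
  using assms
proof (induction xs rule: rev_induct)
  case (snoc y ys)
  show ?case
  proof (cases "ys = []")
    case False
    then have "(R ^^ (length ys - 1)) (hd ys) (last ys)" "R (last ys) y"
      using snoc by (auto simp: successively_append_iff)
    then have "(R ^^ Suc (length ys - 1)) (hd ys) y"
      by auto
    then show ?thesis
      using False by (metis One_nat_def Suc_pred add_diff_cancel_right' hd_append2 last_snoc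
          length_append_singleton length_greater_0_conv Suc_eq_plus1)
  qed simp
qed simp

locale rooted_tree =
  fixes adj :: "'v \<Rightarrow> 'v \<Rightarrow> bool" and x0 :: 'v
  assumes graph_tree: "graph_tree adj"
    and finite_level: "finite (level adj x0 n)"
    and card_children: "card (children adj x0 x) \<ge> 2"
begin

abbreviation lev :: "'v \<Rightarrow> nat" where "lev \<equiv> graph_dist adj x0"
abbreviation S :: "'v \<Rightarrow> 'v set" where "S \<equiv> children adj x0"
abbreviation bd :: "'v set set" where "bd \<equiv> boundary adj x0"

definition parent :: "'v \<Rightarrow> 'v" where "parent y = (THE x. y \<in> S x)"

definition vertex :: "nat \<Rightarrow> 'v set \<Rightarrow> 'v" where "vertex n e = (THE z. z \<in> e \<inter> level adj x0 n)"

section \<open>Levels and parents\<close>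

lemma relpowp_lev: "(adj ^^ lev x) x0 x"
proof -
  \<comment> \<open>Connectedness of the tree supplies a walk from the root, so the minimum behind
    \<open>LEAST\<close> is attained.\<close>
  obtain xs where "graph_path adj x0 xs x"
    using graph_tree unfolding graph_tree_def by blast
  then have "(adj ^^ (length xs - 1)) x0 x"
    using successively_imp_relpowp[of adj xs] by (auto simp: graph_path_def)
  then show ?thesis
    unfolding graph_dist_def by (rule LeastI)
qed

lemma lev_le: "(adj ^^ n) x0 x \<Longrightarrow> lev x \<le> n"
  unfolding graph_dist_def by (rule Least_le)

lemma lev_root [simp]: "lev x0 = 0"
  using lev_le[of 0 x0] by simp

lemma lev_eq_0_iff: "lev x = 0 \<longleftrightarrow> x = x0"
  using relpowp_lev[of x] by (cases "lev x = 0") auto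

lemma children_lev: "y \<in> S x \<Longrightarrow> lev y = Suc (lev x)"
  by (simp add: children_def)

text \<open>The last vertex but one of a shortest walk from the root is a parent: on a lower level
  it would reach \<open>y\<close> too soon.\<close>

lemma ex_parent:
  assumes "lev y = Suc n"
  shows "\<exists>x. y \<in> S x"
proof -
  from relpowp_lev[of y] assms obtain x where x: "(adj ^^ n) x0 x" "adj x y"
    by auto
  then have "lev x \<le> n"
    by (intro lev_le)
  moreover have "lev y \<le> Suc (lev x)"
    using relpowp_lev[of x] x by (intro lev_le) auto
  ultimately show ?thesis
    using assms x by (auto simp: children_def)
qed

text \<open>The level bound makes a new child differ from all earlier vertices, so appending it
  keeps the path simple.\<close>

lemma ex_shortest_path:
  "\<exists>xs. graph_path adj x0 xs x \<and> (\<forall>z\<in>set xs. lev z \<le> lev x)"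
proof (induction "lev x" arbitrary: x)
  case 0
  then have "x = x0"
    using lev_eq_0_iff by simp
  then show ?case
    by (intro exI[of _ "[x0]"]) (auto simp: graph_path_def)
next
  case (Suc n)
  then obtain p where p: "x \<in> S p"
    using ex_parent by metis
  then have "n = lev p"
    using Suc children_lev by simp
  from Suc(1)[OF this] obtain xs where xs: "graph_path adj x0 xs p" "\<forall>z\<in>set xs. lev z \<le> lev p"
    by blast
  then have "graph_path adj x0 (xs @ [x]) x"
    using p by (auto simp: graph_path_def successively_append_iff children_def)
  then show ?case
    using xs children_lev[OF p] by (intro exI[of _ "xs @ [x]"]) auto
qed

text \<open>Two parents would give two simple paths from the root to \<open>y\<close>, with
  different last vertices but one.\<close>

lemma parent_unique:
  assumes "y \<in> S x" "y \<in> S x'"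
  shows "x = x'"
proof -
  have path: "\<exists>xs. graph_path adj x0 (xs @ [y]) y \<and> last xs = u" if "y \<in> S u" for u
  proof -
    obtain xs where "graph_path adj x0 xs u" "\<forall>z\<in>set xs. lev z \<le> lev u"
      using ex_shortest_path by blast
    then have "graph_path adj x0 (xs @ [y]) y \<and> last xs = u"
      using that by (auto simp: graph_path_def successively_append_iff children_def)
    then show ?thesis ..
  qed
  obtain xs xs' where "graph_path adj x0 (xs @ [y]) y" "last xs = x"
    "graph_path adj x0 (xs' @ [y]) y" "last xs' = x'"
    using path assms by metis
  moreover from this have "xs @ [y] = xs' @ [y]"
    using graph_tree unfolding graph_tree_def by blast
  ultimately show ?thesis
    by simp
qed

lemma parent_eq: "y \<in> S x \<Longrightarrow> parent y = x"
  unfolding parent_def using parent_unique by blast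

lemma in_children_parent:
  assumes "x \<noteq> x0"
  shows "x \<in> S (parent x)"
proof -
  have "lev x \<noteq> 0"
    using assms by (simp add: lev_eq_0_iff)
  then obtain n where "lev x = Suc n"
    by (cases "lev x") auto
  then obtain p where "x \<in> S p"
    using ex_parent by blast
  then show ?thesis
    by (simp add: parent_eq)
qed

lemma lev_parent: "x \<noteq> x0 \<Longrightarrow> lev x = Suc (lev (parent x))"
  using in_children_parent children_lev by blast

lemma finite_children [simp]: "finite (S x)"
  using card_children[of x] by (intro card_ge_0_finite) linarith

section \<open>Vertices along a geodesic\<close>

lemma boundaryE:
  assumes "e \<in> bd"
  obtains z where "z 0 = x0" "\<And>n. z (Suc n) \<in> S (z n)" "e = range z" "\<And>n. lev (z n) = n"
    "\<And>n. vertex n e = z n"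
proof -
  obtain z where z: "z 0 = x0" "\<And>n. z (Suc n) \<in> S (z n)" "e = range z"
    using assms unfolding boundary_def by blast
  have lev: "lev (z n) = n" for n
    by (induction n) (simp_all add: z(1) children_lev[OF z(2)])
  \<comment> \<open>The levels along \<open>z\<close> are its indices, so \<open>z n\<close> is the
    only vertex of \<open>e\<close> on level \<open>n\<close>.\<close>
  have "vertex n e = z n" for n
    unfolding vertex_def
  proof (rule the_equality)
    show "z n \<in> e \<inter> level adj x0 n"
      using lev z by (auto simp: level_def)
  qed (use lev z in \<open>auto simp: level_def\<close>)
  with z lev that show ?thesis
    by blast
qed

lemma vertex_0: "e \<in> bd \<Longrightarrow> vertex 0 e = x0"
  by (auto elim: boundaryE)

lemma vertex_Suc: "e \<in> bd \<Longrightarrow> vertex (Suc n) e \<in> S (vertex n e)"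
  by (auto elim: boundaryE)

lemma lev_vertex [simp]: "e \<in> bd \<Longrightarrow> lev (vertex n e) = n"
  by (auto elim: boundaryE)

lemma in_boundary_iff:
  assumes "e \<in> bd"
  shows "x \<in> e \<longleftrightarrow> vertex (lev x) e = x"
proof -
  obtain z where "e = range z" "\<And>n. lev (z n) = n" "\<And>n. vertex n e = z n"
    using boundaryE[OF assms] by blast
  then show ?thesis
    by (metis rangeE rangeI)
qed

text \<open>By uniqueness of parents, geodesics that meet on some level have the same past.\<close>

lemma vertex_eq_mono:
  assumes "e \<in> bd" "e' \<in> bd" "vertex m e = vertex m e'" "n \<le> m"
  shows "vertex n e = vertex n e'"
  using \<open>n \<le> m\<close>
proof (induction rule: inc_induct)
  case (step k)
  then show ?case
    using vertex_Suc[OF assms(1), of k] vertex_Suc[OF assms(2), of k] parent_unique by metis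
qed (use assms in simp)

lemma ex_root_path:
  "\<exists>y. y 0 = x0 \<and> (\<forall>j<lev x. y (Suc j) \<in> S (y j)) \<and> y (lev x) = x"
proof (induction "lev x" arbitrary: x)
  case 0
  then show ?case
    using lev_eq_0_iff by (intro exI[of _ "\<lambda>_. x0"]) auto
next
  case (Suc n)
  then have "x \<noteq> x0"
    by auto
  note p = in_children_parent[OF this] lev_parent[OF this]
  with Suc obtain y where y: "y 0 = x0" "\<forall>j<n. y (Suc j) \<in> S (y j)" "y n = parent x"
    by (metis nat.inject)
  then show ?case
    using p Suc(2) by (intro exI[of _ "y(Suc n := x)"]) (auto simp: less_Suc_eq)
qed

end

section \<open>Harmonic functions with prescribed free values\<close>

locale harmonic_tree = rooted_tree adj x0
  for adj :: "'v \<Rightarrow> 'v \<Rightarrow> bool" and x0 :: 'v +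
  fixes c :: "'v \<Rightarrow> 'v"
    and smul :: "'k::{field, metric_space} \<Rightarrow> 'e::{ab_group_add, metric_space} \<Rightarrow> 'e"
    and w :: "'v \<Rightarrow> 'v \<Rightarrow> 'k"
  assumes marked_child: "c x \<in> children adj x0 x"
    and tvs: "metric_tvs smul"
    and weight_nonzero: "y \<in> children adj x0 x \<Longrightarrow> w x y \<noteq> 0"
    and weight_sum: "(\<Sum>y\<in>children adj x0 x. w x y) = 1"
begin

sublocale vector_space smul
  using tvs by (simp add: metric_tvs_def)

abbreviation H :: "('v \<Rightarrow> 'e) set" where "H \<equiv> harmonic_funs adj x0 smul w"

text \<open>The value at a marked child solves the harmonicity equation at its parent. The siblings
  are unmarked and enter through \<open>a\<close> itself, so the recursion only climbs to the
  parent.\<close>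

function ext :: "('v \<Rightarrow> 'e) \<Rightarrow> 'v \<Rightarrow> 'e" where
  "ext a x = (if x = x0 \<or> x \<noteq> c (parent x) then a x
     else smul (inverse (w (parent x) x))
       (ext a (parent x) - (\<Sum>y\<in>S (parent x) - {x}. smul (w (parent x) y) (a y))))"
  by pat_completeness auto
termination
  by (relation "Wellfounded.measure (\<lambda>(a, x). lev x)") (auto simp: lev_parent)

declare ext.simps [simp del]

lemma ext_unmarked: "x = x0 \<or> x \<noteq> c (parent x) \<Longrightarrow> ext a x = a x"
  by (subst ext.simps) (rule if_P)

lemma ext_marked:
  "ext a (c x) = smul (inverse (w x (c x))) (ext a x - (\<Sum>y\<in>S x - {c x}. smul (w x y) (a y)))"
proof -
  have "parent (c x) = x"
    by (rule parent_eq[OF marked_child])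
  moreover have "c x \<noteq> x0"
    using children_lev[OF marked_child, of x] lev_root by fastforce
  ultimately show ?thesis
    by (subst ext.simps) simp
qed

lemma sum_children_marked:
  fixes g :: "'v \<Rightarrow> 'b::comm_monoid_add"
  shows "(\<Sum>y\<in>S x. g y) = g (c x) + (\<Sum>y\<in>S x - {c x}. g y)"
  by (rule sum.remove) (simp_all add: marked_child)

lemma ext_unmarked_child: "y \<in> S x - {c x} \<Longrightarrow> ext a y = a y"
  by (rule ext_unmarked) (auto simp: parent_eq)

lemma ext_harmonic: "ext a \<in> H"
proof -
  have "ext a x = (\<Sum>y\<in>S x. smul (w x y) (ext a y))" for x
  proof -
    have "smul (w x (c x)) (ext a (c x)) = ext a x - (\<Sum>y\<in>S x - {c x}. smul (w x y) (a y))"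
      using weight_nonzero[OF marked_child, of x] by (simp add: ext_marked)
    moreover have "(\<Sum>y\<in>S x - {c x}. smul (w x y) (ext a y)) = (\<Sum>y\<in>S x - {c x}. smul (w x y) (a y))"
      by (intro sum.cong) (auto simp: ext_unmarked_child)
    ultimately show ?thesis
      by (simp add: sum_children_marked)
  qed
  then show ?thesis
    unfolding harmonic_funs_def by blast
qed

text \<open>A harmonic function satisfies the equation that \<open>ext\<close> solves, so its marked
  values are forced by its free values, level by level.\<close>

lemma ext_of_harmonic:
  assumes "f \<in> H"
  shows "ext f = f"
proof
  fix x
  show "ext f x = f x"
  proof (induction "lev x" arbitrary: x rule: less_induct)
    case less
    show ?case
    proof (cases "x = x0 \<or> x \<noteq> c (parent x)")
      case False
      define p where "p = parent x"
      have x: "x = c p"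
        using False by (simp add: p_def)
      have "lev p < lev x"
        using False by (simp add: p_def lev_parent)
      then have "ext f p = f p"
        by (rule less)
      also have "\<dots> = (\<Sum>y\<in>S p. smul (w p y) (f y))"
        using assms unfolding harmonic_funs_def by blast
      also have "\<dots> = smul (w p (c p)) (f (c p)) + (\<Sum>y\<in>S p - {c p}. smul (w p y) (f y))"
        by (rule sum_children_marked)
      finally show ?thesis
        using weight_nonzero[OF marked_child, of p] by (simp add: x ext_marked)
    qed (rule ext_unmarked)
  qed
qed

section \<open>Continuity of the extension under pointwise convergence\<close>

lemma tendsto_add_tvs:
  fixes u v :: 'e
  assumes "(f \<longlongrightarrow> u) F" "(g \<longlongrightarrow> v) F"
  shows "((\<lambda>i. f i + g i) \<longlongrightarrow> u + v) F"
proof -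
  have "isCont (\<lambda>(u::'e, v). u + v) (u, v)"
    using tvs by (auto simp: metric_tvs_def continuous_on_eq_continuous_at)
  from isCont_tendsto_compose[OF this tendsto_Pair[OF assms]] show ?thesis
    by simp
qed

lemma tendsto_smul:
  assumes "(f \<longlongrightarrow> u) F"
  shows "((\<lambda>i. smul t (f i)) \<longlongrightarrow> smul t u) F"
proof -
  have "isCont (\<lambda>(a, v). smul a v) (t, u)"
    using tvs by (auto simp: metric_tvs_def continuous_on_eq_continuous_at)
  from isCont_tendsto_compose[OF this tendsto_Pair[OF tendsto_const assms]] show ?thesis
    by simp
qed

lemma tendsto_diff_tvs:
  fixes u v :: 'e
  assumes "(f \<longlongrightarrow> u) F" "(g \<longlongrightarrow> v) F"
  shows "((\<lambda>i. f i - g i) \<longlongrightarrow> u - v) F"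
  using tendsto_add_tvs[OF assms(1) tendsto_smul[OF assms(2), of "-1"]] by simp

lemma tendsto_sum_tvs:
  fixes g :: "'a \<Rightarrow> 'e"
  assumes "\<And>y. y \<in> A \<Longrightarrow> ((\<lambda>i. f i y) \<longlongrightarrow> g y) F"
  shows "((\<lambda>i. \<Sum>y\<in>A. f i y) \<longlongrightarrow> (\<Sum>y\<in>A. g y)) F"
  using assms by (induction A rule: infinite_finite_induct) (auto intro: tendsto_add_tvs)

text \<open>Each value of \<open>ext\<close> arises from finitely many free values by continuous
  vector space operations.\<close>

lemma tendsto_ext:
  assumes "\<And>x. ((\<lambda>i. a i x) \<longlongrightarrow> h x) F"
  shows "((\<lambda>i. ext (a i) x) \<longlongrightarrow> ext h x) F"
proof (induction "lev x" arbitrary: x rule: less_induct)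
  case less
  show ?case
  proof (cases "x = x0 \<or> x \<noteq> c (parent x)")
    case True
    then show ?thesis
      using assms by (simp add: ext_unmarked)
  next
    case False
    then have "lev (parent x) < lev x"
      by (simp add: lev_parent)
    then have "((\<lambda>i. ext (a i) (c (parent x))) \<longlongrightarrow> ext h (c (parent x))) F"
      unfolding ext_marked
      by (intro tendsto_smul tendsto_diff_tvs tendsto_sum_tvs less assms)
    then show ?thesis
      using False by simp
  qed
qed

text \<open>Constants solve the harmonicity equation because the weights sum to 1, so a value shared by a
  vertex and its unmarked children passes to the marked child.\<close>

lemma ext_eq_off_marked_paths:
  assumes "n < lev x" "lev x \<le> N" "\<And>k z. lev z = n \<Longrightarrow> x \<noteq> (c ^^ k) z"
    and free: "\<And>y. n < lev y \<Longrightarrow> lev y \<le> N \<Longrightarrow> a y = g y"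
    and const: "\<And>y z. n < lev y \<Longrightarrow> z \<in> S y \<Longrightarrow> g z = g y"
  shows "ext a x = g x"
  using assms(1-3)
proof (induction "lev x" arbitrary: x rule: less_induct)
  case less
  show ?case
  proof (cases "x \<noteq> c (parent x)")
    case False
    define p where "p = parent x"
    have x: "x = c p" and "x \<noteq> x0"
      using False less.prems by (auto simp: p_def)
    then have lev: "lev x = Suc (lev p)"
      by (simp add: p_def lev_parent)
    \<comment> \<open>Otherwise \<open>x\<close> would end a marked path of one step from level
      \<open>n\<close>.\<close>
    have "lev p \<noteq> n"
      using less.prems(3)[of p 1] x by auto
    then have np: "n < lev p"
      using lev less.prems by simp
    have p: "ext a p = g p"
    proof (rule less.hyps)
      \<comment> \<open>A marked path reaching \<open>p\<close> would reach \<open>x\<close> in one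
        more step.\<close>
      show "p \<noteq> (c ^^ k) z" if "lev z = n" for k z
        using less.prems(3)[OF that, of "Suc k"] x by auto
    qed (use lev np less.prems in auto)
    have w: "(\<Sum>y\<in>S p - {c p}. w p y) = 1 - w p (c p)"
      using weight_sum[of p] sum_children_marked[of "w p" p] by (simp add: algebra_simps)
    have "(\<Sum>y\<in>S p - {c p}. smul (w p y) (a y)) = smul (1 - w p (c p)) (g p)"
    proof -
      have "(\<Sum>y\<in>S p - {c p}. smul (w p y) (a y)) = (\<Sum>y\<in>S p - {c p}. smul (w p y) (g p))"
      proof (intro sum.cong refl)
        fix y assume "y \<in> S p - {c p}"
        then show "smul (w p y) (a y) = smul (w p y) (g p)"
          using free[of y] const[OF np, of y] children_lev[of y p] lev less.prems np by simp
      qed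
      also have "\<dots> = smul (1 - w p (c p)) (g p)"
        by (simp only: scale_sum_left [symmetric] w)
      finally show ?thesis .
    qed
    then have "ext a x = smul (inverse (w p (c p))) (g p - smul (1 - w p (c p)) (g p))"
      by (simp only: x ext_marked p)
    also have "\<dots> = g p"
      using weight_nonzero[OF marked_child, of p] by (simp add: scale_left_diff_distrib)
    also have "\<dots> = g x"
      using const[OF np marked_child] by (simp add: x)
    finally show ?thesis .
  qed (use less free in \<open>simp add: ext_unmarked\<close>)
qed

end

section \<open>Measurable functions on the boundary\<close>

locale tree_measure = rooted_tree adj x0
  for adj :: "'v \<Rightarrow> 'v \<Rightarrow> bool" and x0 :: 'v +
  fixes c :: "'v \<Rightarrow> 'v" and q :: "'v \<Rightarrow> 'v \<Rightarrow> real" and Pr :: "'v set measure"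
  assumes marked_child: "c x \<in> children adj x0 x"
    and boundary_measure: "boundary_measure adj x0 q Pr"
    and marked_le_half: "q x (c x) \<le> 1 / 2"
begin

abbreviation B :: "'v \<Rightarrow> 'v set set" where "B \<equiv> cylinder adj x0"

section \<open>Probabilities of cylinders and marked paths\<close>

lemma base_measure:
  obtains N where "prob_space N" "space N = bd"
    "sets N = sigma_sets bd (\<Union>n\<in>{1..}. level_algebra adj x0 n)" "Pr = completion N"
  using boundary_measure unfolding boundary_measure_def by blast

sublocale prob_space Pr
  using base_measure prob_space.prob_space_completion by metis

lemma space_Pr [simp]: "space Pr = bd"
  using base_measure space_completion by metis

lemma cylinder_root [simp]: "B x0 = bd"
  by (auto simp: cylinder_def in_boundary_iff vertex_0)

lemma cylinder_iff: "e \<in> B x \<longleftrightarrow> e \<in> bd \<and> vertex (lev x) e = x"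
  by (auto simp: cylinder_def in_boundary_iff)

lemma cylinder_sets [measurable, simp]: "B x \<in> sets Pr"
proof (cases "x = x0")
  \<comment> \<open>The generating algebras start at level 1; the cylinder of the root is the whole
    space and is treated apart.\<close>
  case True
  then show ?thesis
    using sets.top[of Pr] by simp
next
  case False
  then have "lev x \<ge> 1"
    using lev_eq_0_iff[of x] by linarith
  moreover have "B x \<in> level_algebra adj x0 (lev x)"
    unfolding level_algebra_def by (intro sigma_sets.Basic) (auto simp: level_def)
  ultimately have "B x \<in> sigma_sets bd (\<Union>n\<in>{1..}. level_algebra adj x0 n)"
    by (intro sigma_sets.Basic) auto
  then show ?thesis
    by (metis base_measure sets_completionI_sets)
qed

lemma prob_cylinder_path:
  assumes "y 0 = x0" "\<And>j. j < n \<Longrightarrow> y (Suc j) \<in> S (y j)"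
  shows "prob (B (y n)) = (\<Prod>j<n. q (y j) (y (Suc j)))"
proof (cases "n = 0")
  \<comment> \<open>\<open>boundary_measure\<close> prescribes values from level 1 on; on level 0
    the empty product matches the total mass.\<close>
  case True
  then show ?thesis
    using prob_space by (simp add: assms(1))
next
  case False
  then show ?thesis
    using boundary_measure assms unfolding boundary_measure_def by simp
qed

lemma prob_cylinder_child:
  assumes "x' \<in> S x"
  shows "prob (B x') = prob (B x) * q x x'"
proof -
  obtain y where y: "y 0 = x0" "\<And>j. j < lev x \<Longrightarrow> y (Suc j) \<in> S (y j)" "y (lev x) = x"
    using ex_root_path by blast
  define y' where "y' = y(Suc (lev x) := x')"
  have "prob (B (y' (Suc (lev x)))) = (\<Prod>j<Suc (lev x). q (y' j) (y' (Suc j)))"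
    by (rule prob_cylinder_path) (use y assms in \<open>auto simp: y'_def less_Suc_eq\<close>)
  also have "\<dots> = (\<Prod>j<lev x. q (y j) (y (Suc j))) * q x x'"
    using y(3) by (simp add: y'_def)
  also have "\<dots> = prob (B x) * q x x'"
    using prob_cylinder_path[of y "lev x"] y by simp
  finally show ?thesis
    by (simp add: y'_def)
qed

lemma prob_cylinder_marked: "prob (B ((c ^^ k) x)) \<le> (1 / 2) ^ k * prob (B x)"
proof (induction k)
  case (Suc k)
  have "prob (B ((c ^^ Suc k) x)) = prob (B ((c ^^ k) x)) * q ((c ^^ k) x) (c ((c ^^ k) x))"
    using prob_cylinder_child[OF marked_child] by simp
  also have "\<dots> \<le> prob (B ((c ^^ k) x)) * (1 / 2)"
    by (intro mult_left_mono marked_le_half) simp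
  also have "\<dots> \<le> ((1 / 2) ^ k * prob (B x)) * (1 / 2)"
    by (intro mult_right_mono Suc) simp
  finally show ?case
    by simp
qed simp

text \<open>By uniqueness of parents, these are the geodesics that take the marked child at each of
  the \<open>k\<close> steps after level \<open>n\<close>.\<close>

definition marked_tail :: "nat \<Rightarrow> nat \<Rightarrow> 'v set set" where
  "marked_tail n k = (\<Union>x\<in>level adj x0 n. B ((c ^^ k) x))"

lemma marked_tail_sets [simp]: "marked_tail n k \<in> sets Pr"
  unfolding marked_tail_def by (intro sets.finite_UN finite_level) simp

lemma prob_marked_tail: "prob (marked_tail n k) \<le> (1 / 2) ^ k"
proof -
  have "prob (marked_tail n k) \<le> (\<Sum>x\<in>level adj x0 n. prob (B ((c ^^ k) x)))"
    unfolding marked_tail_def by (intro finite_measure_subadditive_finite finite_level) auto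
  also have "\<dots> \<le> (\<Sum>x\<in>level adj x0 n. (1 / 2) ^ k * prob (B x))"
    by (intro sum_mono prob_cylinder_marked)
  also have "\<dots> = (1 / 2) ^ k * (\<Sum>x\<in>level adj x0 n. prob (B x))"
    by (simp add: sum_distrib_left)
  \<comment> \<open>Cylinders of different vertices of one level are disjoint, so their
    probabilities sum to at most 1.\<close>
  also have "(\<Sum>x\<in>level adj x0 n. prob (B x)) = prob (\<Union>x\<in>level adj x0 n. B x)"
    by (rule finite_measure_finite_Union [symmetric])
      (use finite_level in \<open>auto simp: disjoint_family_on_def cylinder_iff level_def\<close>)
  also have "(1 / 2) ^ k * \<dots> \<le> (1 / 2) ^ k * 1"
    by (intro mult_left_mono) auto
  finally show ?thesis
    by simp
qed

section \<open>Approximation of events and measurable functions by one level of the tree\<close>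

definition determined :: "nat \<Rightarrow> 'v set set \<Rightarrow> bool" where
  "determined n A \<longleftrightarrow>
     A \<subseteq> bd \<and> (\<forall>e\<in>A. \<forall>e'\<in>bd. vertex n e = vertex n e' \<longrightarrow> e' \<in> A)"

lemma determined_mono: "determined n A \<Longrightarrow> n \<le> m \<Longrightarrow> determined m A"
  unfolding determined_def using vertex_eq_mono by blast

lemma determined_Compl: "determined n A \<Longrightarrow> determined n (bd - A)"
  unfolding determined_def by (metis DiffD1 DiffD2 DiffI subsetI)

lemma determined_UN: "(\<And>i. i \<in> I \<Longrightarrow> determined n (A i)) \<Longrightarrow> determined n (\<Union>i\<in>I. A i)"
  unfolding determined_def by blast

text \<open>Such a set is a union of cylinders of level \<open>n\<close>, and that level is
  finite.\<close>

lemma determined_sets: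
  assumes "determined n A"
  shows "A \<in> sets Pr"
proof -
  have sub: "A \<subseteq> bd"
    using assms by (simp add: determined_def)
  have "B (vertex n e) \<subseteq> A" if "e \<in> A" for e
  proof
    fix e' assume "e' \<in> B (vertex n e)"
    moreover have "e \<in> bd"
      using that sub by blast
    ultimately have "e' \<in> bd" "vertex n e = vertex n e'"
      by (simp_all add: cylinder_iff)
    then show "e' \<in> A"
      using assms that by (simp add: determined_def)
  qed
  moreover have "e \<in> B (vertex n e)" if "e \<in> A" for e
    using that sub by (simp add: cylinder_iff subset_eq)
  ultimately have "A = (\<Union>x\<in>vertex n ` A. B x)"
    by blast
  moreover have "vertex n ` A \<subseteq> level adj x0 n"
    using assms by (auto simp: determined_def level_def)
  then have "finite (vertex n ` A)"
    using finite_level finite_subset by blast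
  ultimately show ?thesis
    by (metis sets.finite_UN cylinder_sets)
qed

text \<open>Generation is traded for dependence on the vertex at level \<open>n\<close>, a property
  that passes to complements, unions and higher levels by plain set reasoning.\<close>

lemma level_algebra_determined: "A \<in> level_algebra adj x0 n \<Longrightarrow> determined n A"
  unfolding level_algebra_def
proof (induction rule: sigma_sets.induct)
  case (Basic A)
  then show ?case
    by (auto simp: determined_def cylinder_iff level_def)
next
  case Empty
  then show ?case
    by (simp add: determined_def)
next
  case (Union A)
  then show ?case
    by (intro determined_UN)
qed (rule determined_Compl)

definition approximable :: "'v set set \<Rightarrow> bool" where
  "approximable A \<longleftrightarrow>
     A \<in> sets Pr \<and> (\<forall>\<epsilon>>0. \<exists>n C. determined n C \<and> prob ((A - C) \<union> (C - A)) < \<epsilon>)"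

text \<open>Approximants found on different levels can all be moved to one higher level by
  \<open>determined_mono\<close>.\<close>

lemma approximable_simultaneous:
  fixes \<epsilon> :: real
  assumes "\<And>i. i < (K::nat) \<Longrightarrow> approximable (A i)" "\<epsilon> > 0"
  obtains n C where "n \<ge> 1" "\<And>i. i < K \<Longrightarrow> determined n (C i)"
    "(\<Union>i<K. (A i - C i) \<union> (C i - A i)) \<in> sets Pr"
    "prob (\<Union>i<K. (A i - C i) \<union> (C i - A i)) < \<epsilon>"
proof -
  \<comment> \<open>Dividing by \<open>Suc K\<close> keeps the sum of the \<open>K\<close> errors
    strictly below \<open>\<epsilon>\<close>, also for \<open>K = 0\<close>.\<close>
  have "\<forall>i. \<exists>n C. i < K \<longrightarrow> determined n C \<and> prob ((A i - C) \<union> (C - A i)) < \<epsilon> / Suc K"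
    using assms by (auto simp: approximable_def)
  then obtain n C where C: "determined (n i) (C i)"
    "prob ((A i - C i) \<union> (C i - A i)) < \<epsilon> / Suc K" if "i < K" for i
    by metis
  define D where "D i = (A i - C i) \<union> (C i - A i)" for i
  have D: "D i \<in> sets Pr" if "i < K" for i
    using assms(1)[OF that] C(1)[OF that, THEN determined_sets] unfolding D_def approximable_def
    by blast
  have "prob (\<Union>i<K. D i) \<le> (\<Sum>i<K. prob (D i))"
    using D by (intro finite_measure_subadditive_finite) auto
  also have "\<dots> \<le> (\<Sum>i<K. \<epsilon> / Suc K)"
    using C(2) by (intro sum_mono) (auto simp: D_def intro: less_imp_le)
  also have "\<dots> < \<epsilon>"
    using assms(2) by (simp add: field_simps)
  finally have "prob (\<Union>i<K. D i) < \<epsilon>" .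
  \<comment> \<open>The sum bounds each single level, and the successor makes the common level at
    least 1.\<close>
  moreover have "determined (Suc (\<Sum>i<K. n i)) (C i)" if "i < K" for i
  proof (rule determined_mono)
    have "n i \<le> (\<Sum>i<K. n i)"
      using that by (intro member_le_sum) auto
    then show "n i \<le> Suc (\<Sum>i<K. n i)"
      by simp
  qed (rule C(1)[OF that])
  moreover have "(\<Union>i<K. D i) \<in> sets Pr"
    using D by (intro sets.finite_UN) auto
  ultimately show ?thesis
    using that[of "Suc (\<Sum>i<K. n i)" C] by (simp add: D_def)
qed

text \<open>Continuity from below along the finite partial unions.\<close>

lemma prob_Union_tail:
  fixes \<epsilon> :: real
  assumes "\<And>i::nat. A i \<in> sets Pr" "\<epsilon> > 0"
  obtains K where "prob ((\<Union>i. A i) - (\<Union>i<K. A i)) < \<epsilon>"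
proof -
  have "(\<lambda>K. prob (\<Union>i<K. A i)) \<longlonglongrightarrow> prob (\<Union>K. \<Union>i<K. A i)"
    using assms by (intro finite_Lim_measure_incseq) (auto simp: incseq_def intro: less_le_trans)
  moreover have "(\<Union>K. \<Union>i<K. A i) = (\<Union>i. A i)"
    by auto
  ultimately have "\<forall>\<^sub>F K in sequentially. prob (\<Union>i. A i) - \<epsilon> < prob (\<Union>i<K. A i)"
    using assms(2) by (intro order_tendstoD(1)) auto
  then obtain K where "prob (\<Union>i. A i) - \<epsilon> < prob (\<Union>i<K. A i)"
    by (auto simp: eventually_sequentially)
  moreover have "prob ((\<Union>i. A i) - (\<Union>i<K. A i)) = prob (\<Union>i. A i) - prob (\<Union>i<K. A i)"
    using assms by (intro finite_measure_Diff) auto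
  ultimately show ?thesis
    by (intro that[of K]) linarith
qed

text \<open>Half of the error is spent on cutting the union off at a finite stage, half on
  approximating the remaining sets on a common level.\<close>

lemma approximable_UN:
  assumes "\<And>i::nat. approximable (A i)"
  shows "approximable (\<Union>i. A i)"
  unfolding approximable_def
proof (intro conjI allI impI)
  have sets: "A i \<in> sets Pr" for i
    using assms by (simp add: approximable_def)
  then show union: "(\<Union>i. A i) \<in> sets Pr"
    by blast
  fix \<epsilon> :: real
  assume "\<epsilon> > 0"
  then have \<epsilon>: "\<epsilon> / 2 > 0"
    by simp
  obtain K where K: "prob ((\<Union>i. A i) - (\<Union>i<K. A i)) < \<epsilon> / 2"
    by (rule prob_Union_tail[of A, OF sets \<epsilon>])
  obtain n C where C: "n \<ge> 1" "\<And>i. i < K \<Longrightarrow> determined n (C i)"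
    "(\<Union>i<K. (A i - C i) \<union> (C i - A i)) \<in> sets Pr"
    "prob (\<Union>i<K. (A i - C i) \<union> (C i - A i)) < \<epsilon> / 2"
    by (rule approximable_simultaneous[of K A, OF assms \<epsilon>]) (rule that)
  have tail: "(\<Union>i. A i) - (\<Union>i<K. A i) \<in> sets Pr"
    using union by (rule sets.Diff) (use sets in \<open>auto intro: sets.finite_UN\<close>)
  define D where "D = (\<Union>i<K. C i)"
  have det: "determined n D"
    unfolding D_def using C(2) by (intro determined_UN) auto
  have "prob (((\<Union>i. A i) - D) \<union> (D - (\<Union>i. A i)))
      \<le> prob (((\<Union>i. A i) - (\<Union>i<K. A i)) \<union> (\<Union>i<K. (A i - C i) \<union> (C i - A i)))"
  proof (rule finite_measure_mono)
    show "((\<Union>i. A i) - D) \<union> (D - (\<Union>i. A i))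
        \<subseteq> ((\<Union>i. A i) - (\<Union>i<K. A i)) \<union> (\<Union>i<K. (A i - C i) \<union> (C i - A i))"
      unfolding D_def by blast
    show "((\<Union>i. A i) - (\<Union>i<K. A i)) \<union> (\<Union>i<K. (A i - C i) \<union> (C i - A i)) \<in> sets Pr"
      using tail C(3) by (rule sets.Un)
  qed
  also have "\<dots> \<le> prob ((\<Union>i. A i) - (\<Union>i<K. A i)) + prob (\<Union>i<K. (A i - C i) \<union> (C i - A i))"
    using tail C(3) by (rule measure_Un_le)
  also have "\<dots> < \<epsilon>"
    using K C(4) by simp
  finally show "\<exists>n C. determined n C \<and> prob (((\<Union>i. A i) - C) \<union> (C - (\<Union>i. A i))) < \<epsilon>"
    using det by blast
qed

lemma approximable_sigma_sets:
  assumes "A \<in> sigma_sets bd (\<Union>n\<in>{1..}. level_algebra adj x0 n)"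
  shows "approximable A"
  using assms
proof (induction rule: sigma_sets.induct)
  case (Basic A)
  then obtain n where "determined n A"
    using level_algebra_determined by blast
  then show ?case
    unfolding approximable_def using determined_sets by (auto intro!: exI[of _ n] exI[of _ A])
next
  case Empty
  have "determined 0 {}"
    by (simp add: determined_def)
  then show ?case
    unfolding approximable_def by (auto intro!: exI[of _ "0::nat"] exI[of _ "{}"])
next
  case (Compl A)
  show ?case
    unfolding approximable_def
  proof (intro conjI allI impI)
    show "bd - A \<in> sets Pr"
      using Compl sets.compl_sets[of A Pr] by (simp add: approximable_def)
    fix \<epsilon> :: real
    assume "\<epsilon> > 0"
    then obtain n C where C: "determined n C" "prob ((A - C) \<union> (C - A)) < \<epsilon>"
      using Compl unfolding approximable_def by blast
    have "A \<subseteq> bd"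
      using Compl sets.sets_into_space[of A Pr] by (simp add: approximable_def)
    moreover have "C \<subseteq> bd"
      using C(1) by (simp add: determined_def)
    \<comment> \<open>Passing to complements leaves the symmetric difference unchanged.\<close>
    ultimately have "((bd - A) - (bd - C)) \<union> ((bd - C) - (bd - A)) = (A - C) \<union> (C - A)"
      by blast
    then show "\<exists>n C. determined n C \<and> prob (((bd - A) - C) \<union> (C - (bd - A))) < \<epsilon>"
      using C determined_Compl by metis
  qed
qed (rule approximable_UN)

text \<open>Completion only adds subsets of null sets, and these do not raise the probability of the
  symmetric difference.\<close>

lemma approximable_sets:
  assumes "A \<in> sets Pr"
  shows "approximable A"
proof -
  obtain N where N: "prob_space N" "space N = bd"
    "sets N = sigma_sets bd (\<Union>n\<in>{1..}. level_algebra adj x0 n)" "Pr = completion N"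
    by (rule base_measure)
  obtain A' Z Z' where A: "A = A' \<union> Z" "Z \<subseteq> Z'" "Z' \<in> null_sets N" "A' \<in> sets N"
    using assms unfolding N(4) by (rule sets_completionE)
  then have null: "Z' \<in> null_sets Pr"
    by (simp add: N(4) null_sets_completionI)
  have A': "approximable A'"
    using A(4) N(3) approximable_sigma_sets by blast
  show ?thesis
    unfolding approximable_def
  proof (intro conjI allI impI)
    fix \<epsilon> :: real
    assume "\<epsilon> > 0"
    then obtain n C where C: "determined n C" "prob ((A' - C) \<union> (C - A')) < \<epsilon>"
      using A' unfolding approximable_def by blast
    have sets: "A' \<in> sets Pr" "C \<in> sets Pr" "Z' \<in> sets Pr"
      using A' C(1) determined_sets null by (auto simp: approximable_def)
    have "prob ((A - C) \<union> (C - A)) \<le> prob (((A' - C) \<union> (C - A')) \<union> Z')"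
      using A(1,2) sets by (intro finite_measure_mono) auto
    also have "\<dots> = prob ((A' - C) \<union> (C - A'))"
      using null sets by (intro measure_Un_null_set) auto
    finally show "\<exists>n C. determined n C \<and> prob ((A - C) \<union> (C - A)) < \<epsilon>"
      using C by (intro exI[of _ n] exI[of _ C]) auto
  qed (rule assms)
qed

text \<open>The preimages of the balls around a countable dense set cover the boundary. Finitely
  many of them cover it up to a small set, and these are replaced by events determined on one
  level.\<close>

lemma measurable_approx:
  fixes \<phi> :: "'v set \<Rightarrow> 'e::metric_space" and E0 :: "'e set"
  assumes "\<phi> \<in> borel_measurable Pr" "countable E0" "closure E0 = UNIV" "\<epsilon> > 0"
  obtains n g Z where "n \<ge> 1" "Z \<in> sets Pr" "prob Z < \<epsilon>"
    "\<And>e. e \<in> bd - Z \<Longrightarrow> dist (g (vertex n e)) (\<phi> e) < \<epsilon>"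
proof -
  have "E0 \<noteq> {}"
    using assms(3) by auto
  define u where "u = from_nat_into E0"
  have range_u: "range u = E0"
    unfolding u_def using \<open>E0 \<noteq> {}\<close> assms(2) by (rule range_from_nat_into)
  define A where "A i = \<phi> -` ball (u i) \<epsilon> \<inter> bd" for i
  have A: "A i \<in> sets Pr" for i
    unfolding A_def using measurable_sets[OF assms(1), of "ball (u i) \<epsilon>"] by simp
  have cover: "(\<Union>i. A i) = bd"
  proof
    show "bd \<subseteq> (\<Union>i. A i)"
    proof
      fix e assume "e \<in> bd"
      have "\<phi> e \<in> closure E0"
        by (simp add: assms(3))
      then obtain v where "v \<in> E0" "dist v (\<phi> e) < \<epsilon>"
        using assms(4) unfolding closure_approachable by blast
      then show "e \<in> (\<Union>i. A i)"
        using \<open>e \<in> bd\<close> range_u by (auto simp: A_def)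
    qed
  qed (auto simp: A_def)
  have \<epsilon>: "\<epsilon> / 2 > 0"
    using assms(4) by simp
  obtain K where K: "prob ((\<Union>i. A i) - (\<Union>i<K. A i)) < \<epsilon> / 2"
    by (rule prob_Union_tail[of A, OF A \<epsilon>])
  obtain n C where C: "n \<ge> 1" "\<And>i. i < K \<Longrightarrow> determined n (C i)"
    "(\<Union>i<K. (A i - C i) \<union> (C i - A i)) \<in> sets Pr"
    "prob (\<Union>i<K. (A i - C i) \<union> (C i - A i)) < \<epsilon> / 2"
    by (rule approximable_simultaneous[of K A, OF approximable_sets[OF A] \<epsilon>]) (rule that)
  \<comment> \<open>\<open>Z\<close> collects the geodesics missed by the first \<open>K\<close>
    preimages and those on which some \<open>C i\<close> differs from \<open>A i\<close>.\<close>
  define Z where "Z = (bd - (\<Union>i<K. A i)) \<union> (\<Union>i<K. (A i - C i) \<union> (C i - A i))"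
  \<comment> \<open>Any index whose approximant contains the cylinder of \<open>x\<close> will do:
    off \<open>Z\<close>, lying in \<open>C i\<close> means lying in \<open>A i\<close>.\<close>
  define pick where "pick x = (SOME i. i < K \<and> (\<exists>e\<in>C i. vertex n e = x))" for x
  have diff: "bd - (\<Union>i<K. A i) \<in> sets Pr"
    using A sets.top[of Pr] by (intro sets.Diff sets.finite_UN) auto
  have "prob Z \<le> prob (bd - (\<Union>i<K. A i)) + prob (\<Union>i<K. (A i - C i) \<union> (C i - A i))"
    unfolding Z_def using diff C(3) by (rule measure_Un_le)
  then have "prob Z < \<epsilon>"
    using K C(4) unfolding cover by simp
  moreover have "dist (u (pick (vertex n e))) (\<phi> e) < \<epsilon>" if e: "e \<in> bd - Z" for e
  proof -
    obtain i where "i < K" "e \<in> A i"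
      using e by (auto simp: Z_def)
    then have "e \<in> C i"
      using e by (auto simp: Z_def)
    then have "\<exists>i. i < K \<and> (\<exists>e'\<in>C i. vertex n e' = vertex n e)"
      using \<open>i < K\<close> by blast
    then have "pick (vertex n e) < K \<and> (\<exists>e'\<in>C (pick (vertex n e)). vertex n e' = vertex n e)"
      unfolding pick_def by (rule someI_ex)
    then obtain e' where p: "pick (vertex n e) < K" "e' \<in> C (pick (vertex n e))"
      "vertex n e' = vertex n e"
      by blast
    then have "e \<in> C (pick (vertex n e))"
      using C(2)[OF p(1)] e unfolding determined_def by blast
    then have "e \<in> A (pick (vertex n e))"
      using e p(1) by (auto simp: Z_def)
    then show ?thesis
      by (simp add: A_def)
  qed
  moreover have "Z \<in> sets Pr"
    unfolding Z_def using diff C(3) by (rule sets.Un)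
  ultimately show ?thesis
    using that[of n Z "u \<circ> pick"] C(1) by simp
qed

section \<open>Estimates in the metric of convergence in probability\<close>

lemma L0_dist_le:
  assumes "Z \<in> sets Pr" "\<eta> \<ge> 0" "\<And>e. e \<in> bd - Z \<Longrightarrow> dist (\<psi> e) (\<phi> e) \<le> \<eta>"
  shows "L0_dist Pr \<psi> \<phi> \<le> \<eta> + prob Z"
proof (cases "integrable Pr (\<lambda>e. dist (\<psi> e) (\<phi> e) / (1 + dist (\<psi> e) (\<phi> e)))")
  case True
  have "L0_dist Pr \<psi> \<phi> \<le> (\<integral>e. \<eta> + indicator Z e \<partial>Pr)"
    unfolding L0_dist_def
  proof (rule integral_mono[OF True])
    show "integrable Pr (\<lambda>e. \<eta> + indicator Z e)"
      using assms(1) by (intro Bochner_Integration.integrable_add integrable_const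
          integrable_real_indicator) (simp_all add: emeasure_eq_measure)
    fix e assume e: "e \<in> space Pr"
    have pos: "1 + dist (\<psi> e) (\<phi> e) > 0"
      by (rule add_pos_nonneg) auto
    \<comment> \<open>The integrand is at most 1 on \<open>Z\<close>, and at most the distance
      itself elsewhere.\<close>
    show "dist (\<psi> e) (\<phi> e) / (1 + dist (\<psi> e) (\<phi> e)) \<le> \<eta> + indicator Z e"
    proof (cases "e \<in> Z")
      case True
      have "dist (\<psi> e) (\<phi> e) / (1 + dist (\<psi> e) (\<phi> e)) \<le> 1"
        using pos by (simp add: divide_le_eq)
      then show ?thesis
        using True assms(2) by simp
    next
      case False
      have "dist (\<psi> e) (\<phi> e) / (1 + dist (\<psi> e) (\<phi> e)) \<le> dist (\<psi> e) (\<phi> e)"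
        using pos by (simp add: divide_le_eq algebra_simps)
      then show ?thesis
        using False assms(3)[of e] e by simp
    qed
  qed
  also have "\<dots> = \<eta> + prob Z"
  proof (subst Bochner_Integration.integral_add)
    show "integrable Pr (indicat_real Z)"
      using assms(1) by (intro integrable_real_indicator) (simp_all add: emeasure_eq_measure)
  qed (use assms(1) prob_space sets.Int_space_eq2[OF assms(1)] in simp_all)
  finally show ?thesis .
next
  \<comment> \<open>The Bochner integral is then 0 by convention, below the nonnegative
    bound.\<close>
  case False
  then show ?thesis
    unfolding L0_dist_def using assms(2) by (simp add: not_integrable_integral_eq)
qed

lemma omega_measurable:
  fixes f :: "'v \<Rightarrow> 'e::metric_space"
  shows "omega adj x0 n f \<in> borel_measurable Pr"
proof (rule measurableI)
  fix X :: "'e set"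
  have "determined n (omega adj x0 n f -` X \<inter> bd)"
    by (auto simp: determined_def omega_def vertex_def)
  then show "omega adj x0 n f -` X \<inter> space Pr \<in> sets Pr"
    using determined_sets by simp
qed simp

end

section \<open>A family whose combinations are universal\<close>

text \<open>A pair will name a member of the family and a target. It needs late windows of every
  length, because a long window makes the marked tail improbable.\<close>

lemma schedule_exists:
  "\<exists>\<tau>::nat \<Rightarrow> nat \<times> nat. \<forall>p k. \<exists>n\<ge>k. \<forall>i. n < i \<and> i \<le> n + k \<longrightarrow> \<tau> i = p"
proof -
  \<comment> \<open>constant on dyadic blocks\<close>
  define \<tau> where "\<tau> i = prod_decode (fst (prod_decode (LEAST m. i < 2 ^ Suc m)))" for i :: nat
  have "\<exists>n\<ge>k. \<forall>i. n < i \<and> i \<le> n + k \<longrightarrow> \<tau> i = p" for p k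
  proof -
    \<comment> \<open>Coding \<open>k\<close> into \<open>m\<close> gives
      \<open>k \<le> m < 2 ^ m\<close>, so the block after \<open>2 ^ m\<close>, which carries
      \<open>p\<close>, is long enough and starts late enough.\<close>
    define m where "m = prod_encode (prod_encode p, k)"
    have "k \<le> m"
      unfolding m_def by (rule le_prod_encode_2)
    have "m < 2 ^ m"
      by (rule less_exp)
    with \<open>k \<le> m\<close> have "k \<le> 2 ^ m"
      by linarith
    moreover have "\<tau> i = p" if i: "2 ^ m < i" "i \<le> 2 ^ m + k" for i
    proof -
      have "(LEAST m. i < 2 ^ Suc m) = m"
      proof (rule Least_equality)
        have "i < 2 ^ m + 2 ^ m"
          using i(2) \<open>k \<le> m\<close> \<open>m < 2 ^ m\<close> by linarith
        then show "i < 2 ^ Suc m"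
          by simp
        show "m \<le> m'" if "i < 2 ^ Suc m'" for m'
        proof -
          have "(2::nat) ^ m < 2 ^ Suc m'"
            using i that by (rule_tac less_trans)
          then show ?thesis
            using power_less_imp_less_exp[of "2::nat" m "Suc m'"] by simp
        qed
      qed
      then show ?thesis
        by (simp add: \<tau>_def m_def)
    qed
    ultimately show ?thesis
      by (intro exI[of _ "2 ^ m"]) auto
  qed
  then show ?thesis
    by blast
qed

lemma closure_pointwise_limit:
  fixes h :: "'a \<Rightarrow> 'b::topological_space"
  assumes "\<And>m. f m \<in> A" "\<And>x. (\<lambda>m. f m x) \<longlonglongrightarrow> h x"
  shows "h \<in> closure A"
proof -
  have "limitin (product_topology (\<lambda>_. euclidean) UNIV) f h sequentially"
    using assms(2) by (simp add: limitin_componentwise)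
  then have "f \<longlonglongrightarrow> h"
    by (simp add: euclidean_product_topology)
  then show ?thesis
    using assms(1) closure_subset[of A]
    by (intro Lim_in_closed_set[of "closure A" f sequentially]) (auto intro!: always_eventually)
qed

locale harmonic_boundary = harmonic_tree adj x0 c smul w + tree_measure adj x0 c q Pr
  for adj :: "'v \<Rightarrow> 'v \<Rightarrow> bool" and x0 :: 'v and c :: "'v \<Rightarrow> 'v"
    and smul :: "'k::{field, metric_space} \<Rightarrow> 'e::{ab_group_add, metric_space} \<Rightarrow> 'e"
    and w :: "'v \<Rightarrow> 'v \<Rightarrow> 'k" and q :: "'v \<Rightarrow> 'v \<Rightarrow> real" and Pr :: "'v set measure" +
  assumes separable: "separable_space (euclidean :: 'e topology)"
begin

section \<open>A countable family of targets\<close>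

lemma countable_dense:
  obtains E0 :: "'e set" where "countable E0" "closure E0 = UNIV"
  using separable unfolding separable_space_def by auto

text \<open>The tolerance varies with the vertex because it will be a modulus of continuity of
  scalar multiplication taken at a point depending on the vertex.\<close>

definition rich_targets :: "(nat \<Rightarrow> 'v \<Rightarrow> 'e) \<Rightarrow> bool" where
  "rich_targets \<delta> \<longleftrightarrow>
     (\<forall>h n \<epsilon>. (\<forall>x. \<epsilon> x > (0::real)) \<longrightarrow>
       (\<exists>j. (\<forall>x. lev x \<le> n \<longrightarrow> dist (\<delta> j x) (h x) < \<epsilon> x) \<and>
            (\<forall>x y. n \<le> lev x \<longrightarrow> y \<in> S x \<longrightarrow> \<delta> j y = \<delta> j x)))"

text \<open>Functions from the finitely many vertices up to level \<open>n\<close> to a countable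
  dense set are countably many; each is continued below level \<open>n\<close> by its value at the
  ancestor there.\<close>

lemma ex_rich_targets: "\<exists>\<delta>. rich_targets \<delta>"
proof -
  obtain E0 :: "'e set" where E0: "countable E0" "closure E0 = UNIV"
    by (rule countable_dense)
  \<comment> \<open>Truncated subtraction makes \<open>anc n x\<close> equal to \<open>x\<close> up
    to level \<open>n\<close>, and to the ancestor on level \<open>n\<close> beyond.\<close>
  define anc where "anc n x = (parent ^^ (lev x - n)) x" for n x
  define D where "D n = (\<lambda>h x. h (anc n x)) ` ({x. lev x \<le> n} \<rightarrow>\<^sub>E E0)" for n
  have "{x. lev x \<le> n} = (\<Union>m\<le>n. level adj x0 m)" for n
    by (auto simp: level_def)
  then have "finite {x. lev x \<le> n}" for n
    using finite_level by simp
  then have "countable (D n)" for n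
    unfolding D_def using E0(1) by (intro countable_image countable_PiE) auto
  then have countable: "countable (\<Union>n. D n)"
    by simp
  have anc_low: "anc n x = x" if "lev x \<le> n" for n x
    using that by (simp add: anc_def)
  have anc_child: "anc n y = anc n x" if "n \<le> lev x" "y \<in> S x" for n x y
    using that by (simp add: anc_def children_lev Suc_diff_le funpow_swap1 parent_eq del: funpow.simps
        add: funpow_Suc_right)
  have rich: "\<exists>d\<in>D n. (\<forall>x. lev x \<le> n \<longrightarrow> dist (d x) (h x) < \<epsilon> x) \<and>
      (\<forall>x y. n \<le> lev x \<longrightarrow> y \<in> S x \<longrightarrow> d y = d x)"
    if "\<forall>x. \<epsilon> x > (0::real)" for h n \<epsilon>
  proof -
    have "\<exists>u\<in>E0. dist u (h x) < \<epsilon> x" for x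
      using that E0(2) closure_approachable[of "h x" E0] by auto
    then obtain u where u: "u x \<in> E0" "dist (u x) (h x) < \<epsilon> x" for x
      by metis
    have "(\<lambda>x. restrict u {x. lev x \<le> n} (anc n x)) \<in> D n"
      unfolding D_def by (intro imageI restrict_PiE_iff[THEN iffD2]) (simp add: u(1))
    then show ?thesis
      by (rule bexI[rotated]) (auto simp: anc_low anc_child u(2))
  qed
  have "(\<Union>n. D n) \<noteq> {}"
    using rich[of "\<lambda>_. 1"] by fastforce
  then have range: "range (from_nat_into (\<Union>n. D n)) = (\<Union>n. D n)"
    using countable by (rule range_from_nat_into)
  have "rich_targets (from_nat_into (\<Union>n. D n))"
    unfolding rich_targets_def
  proof (intro allI impI)
    fix h :: "'v \<Rightarrow> 'e" and n :: nat and \<epsilon> :: "'v \<Rightarrow> real"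
    assume "\<forall>x. \<epsilon> x > 0"
    from rich[OF this] obtain d where d: "d \<in> D n" "\<forall>x. lev x \<le> n \<longrightarrow> dist (d x) (h x) < \<epsilon> x"
      "\<forall>x y. n \<le> lev x \<longrightarrow> y \<in> S x \<longrightarrow> d y = d x"
      by blast
    from d(1) obtain j where "d = from_nat_into (\<Union>n. D n) j"
      using range by blast
    with d(2,3) show "\<exists>j. (\<forall>x. lev x \<le> n \<longrightarrow> dist (from_nat_into (\<Union>n. D n) j x) (h x) < \<epsilon> x) \<and>
        (\<forall>x y. n \<le> lev x \<longrightarrow> y \<in> S x \<longrightarrow>
          from_nat_into (\<Union>n. D n) j y = from_nat_into (\<Union>n. D n) j x)"
      by blast
  qed
  then show ?thesis
    by blast
qed

section \<open>The family of harmonic functions and its density\<close>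

text \<open>The free values of the \<open>l\<close>-th function of the family copy a target up to level \<open>l\<close>, which
  makes the family dense in the space of harmonic functions; afterwards they copy the scheduled
  target on the levels assigned to \<open>l\<close> and vanish on all other levels.\<close>

definition free_values :: "(nat \<Rightarrow> 'v \<Rightarrow> 'e) \<Rightarrow> (nat \<Rightarrow> nat \<times> nat) \<Rightarrow> nat \<Rightarrow> 'v \<Rightarrow> 'e" where
  "free_values \<delta> \<tau> l y =
     (if lev y \<le> l then \<delta> (fst (prod_decode (l div 2))) y
      else if fst (\<tau> (lev y)) = l then \<delta> (snd (\<tau> (lev y))) y else 0)"

text \<open>Members with ever later switching level can copy targets ever closer to
  \<open>h\<close>. Their free values tend to \<open>h\<close> pointwise, and \<open>ext\<close> is
  continuous and fixes \<open>h\<close>.\<close>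

lemma family_dense:
  assumes "rich_targets \<delta>" "\<And>j n. \<exists>l\<ge>n. Q l \<and> fst (prod_decode (l div 2)) = j"
  shows "H \<subseteq> closure ((\<lambda>l. ext (free_values \<delta> \<tau> l)) ` {l. Q l})"
proof
  fix h assume h: "h \<in> H"
  have "\<exists>l. Q l \<and> (\<forall>x. lev x \<le> m \<longrightarrow> dist (free_values \<delta> \<tau> l x) (h x) < inverse (Suc m))" for m
  proof -
    obtain j where j: "\<And>x. lev x \<le> m \<Longrightarrow> dist (\<delta> j x) (h x) < inverse (Suc m)"
      using assms(1)[unfolded rich_targets_def, rule_format, of "\<lambda>_. inverse (Suc m)" m h] by auto
    obtain l where "l \<ge> m" "Q l" "fst (prod_decode (l div 2)) = j"
      using assms(2) by blast
    then show ?thesis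
      using j by (auto simp: free_values_def)
  qed
  then obtain l where l: "Q (l m)"
    "\<And>x. lev x \<le> m \<Longrightarrow> dist (free_values \<delta> \<tau> (l m) x) (h x) < inverse (Suc m)" for m
    by metis
  have "(\<lambda>m. free_values \<delta> \<tau> (l m) x) \<longlonglongrightarrow> h x" for x
  proof (rule metric_tendsto_imp_tendsto[OF LIMSEQ_inverse_real_of_nat])
    have "dist (free_values \<delta> \<tau> (l m) x) (h x) \<le> dist (inverse (real (Suc m))) 0" if "lev x \<le> m" for m
      using l(2)[OF that] by (simp add: dist_real_def)
    then show "\<forall>\<^sub>F m in sequentially.
        dist (free_values \<delta> \<tau> (l m) x) (h x) \<le> dist (inverse (real (Suc m))) 0"
      unfolding eventually_sequentially by blast
  qed
  then have "(\<lambda>m. ext (free_values \<delta> \<tau> (l m)) x) \<longlonglongrightarrow> h x" for x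
    using tendsto_ext[of "\<lambda>m. free_values \<delta> \<tau> (l m)" h] ext_of_harmonic[OF h] by simp
  then show "h \<in> closure ((\<lambda>l. ext (free_values \<delta> \<tau> l)) ` {l. Q l})"
    using l(1) by (intro closure_pointwise_limit[of "\<lambda>m. ext (free_values \<delta> \<tau> (l m))"]) auto
qed

section \<open>Universality of nontrivial combinations\<close>

lemma harmonic_sum:
  assumes "\<And>l. f l \<in> H"
  shows "(\<lambda>x. \<Sum>l<K. smul (a l) (f l x)) \<in> H"
proof -
  have "(\<Sum>l<K. smul (a l) (f l x)) = (\<Sum>y\<in>S x. smul (w x y) (\<Sum>l<K. smul (a l) (f l y)))" for x
  proof -
    have "f l x = (\<Sum>y\<in>S x. smul (w x y) (f l y))" for l
      using assms unfolding harmonic_funs_def by blast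
    then have "(\<Sum>l<K. smul (a l) (f l x)) =
        (\<Sum>l<K. smul (a l) (\<Sum>y\<in>S x. smul (w x y) (f l y)))"
      by metis
    also have "\<dots> = (\<Sum>l<K. \<Sum>y\<in>S x. smul (w x y) (smul (a l) (f l y)))"
      by (simp only: scale_sum_right scale_left_commute)
    also have "\<dots> = (\<Sum>y\<in>S x. \<Sum>l<K. smul (w x y) (smul (a l) (f l y)))"
      by (rule sum.swap)
    finally show ?thesis
      by (simp only: scale_sum_right)
  qed
  then show ?thesis
    unfolding harmonic_funs_def by blast
qed

lemma lev_marked_power: "lev ((c ^^ k) x) = lev x + k"
  by (induction k) (simp_all add: children_lev[OF harmonic_tree.marked_child[OF harmonic_tree_axioms]])

text \<open>On a window scheduled for \<open>(i, j)\<close> only member \<open>i\<close> has nonzero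
  free values, so off the marked paths the combination ends up as \<open>a i\<close> times target
  \<open>j\<close>. That target is chosen near \<open>inverse (a i)\<close> times the wanted
  values.\<close>

lemma universal_combination:
  assumes rich: "rich_targets \<delta>"
    and schedule: "\<forall>p k. \<exists>n\<ge>k. \<forall>i. n < i \<and> i \<le> n + k \<longrightarrow> \<tau> i = p"
    and i: "i < K" "a i \<noteq> 0"
  shows "(\<lambda>x. \<Sum>l<K. smul (a l) (ext (free_values \<delta> \<tau> l) x)) \<in> universal_funs adj x0 Pr smul w"
    (is "?f \<in> _")
proof -
  have "\<exists>N\<ge>1. L0_dist Pr (omega adj x0 N ?f) \<phi> < \<epsilon>"
    if \<phi>: "\<phi> \<in> borel_measurable Pr" and "\<epsilon> > 0" for \<phi> :: "'v set \<Rightarrow> 'e" and \<epsilon> :: real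
  proof -
    \<comment> \<open>Two quarters pay for the distance off the exceptional set, one for
      \<open>Z\<close> and one for the marked tail.\<close>
    define \<eta> where "\<eta> = \<epsilon> / 4"
    have \<eta>: "\<eta> > 0" "4 * \<eta> = \<epsilon>"
      using \<open>\<epsilon> > 0\<close> by (simp_all add: \<eta>_def)
    obtain E0 :: "'e set" where E0: "countable E0" "closure E0 = UNIV"
      by (rule countable_dense)
    obtain n0 g Z where g: "n0 \<ge> 1" "Z \<in> sets Pr" "prob Z < \<eta>"
      "\<And>e. e \<in> bd - Z \<Longrightarrow> dist (g (vertex n0 e)) (\<phi> e) < \<eta>"
      by (rule measurable_approx[OF \<phi> E0 \<eta>(1)]) (rule that)
    have "\<exists>r>0. \<forall>u. dist u (smul (inverse (a i)) (g x)) < r \<longrightarrow> dist (smul (a i) u) (g x) < \<eta>" for x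
    proof -
      have "((\<lambda>u. smul (a i) u) \<longlongrightarrow> smul (a i) (smul (inverse (a i)) (g x)))
          (nhds (smul (inverse (a i)) (g x)))"
        by (intro tendsto_smul filterlim_ident)
      then have "((\<lambda>u. smul (a i) u) \<longlongrightarrow> g x) (nhds (smul (inverse (a i)) (g x)))"
        using i(2) by simp
      from tendstoD[OF this \<eta>(1)] show ?thesis
        by (simp add: eventually_nhds_metric)
    qed
    then obtain r where r: "r x > 0"
      "\<And>u. dist u (smul (inverse (a i)) (g x)) < r x \<Longrightarrow> dist (smul (a i) u) (g x) < \<eta>" for x
      by metis
    obtain j where j: "\<And>x. lev x \<le> n0 \<Longrightarrow> dist (\<delta> j x) (smul (inverse (a i)) (g x)) < r x"
      "\<And>x y. n0 \<le> lev x \<Longrightarrow> y \<in> S x \<Longrightarrow> \<delta> j y = \<delta> j x"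
      using rich[unfolded rich_targets_def, rule_format,
          of r n0 "\<lambda>x. smul (inverse (a i)) (g x)"] r(1) by blast
    obtain k0 where k0: "(1 / 2) ^ k0 < \<eta>"
      using real_arch_pow_inv[of \<eta> "1 / 2"] \<eta>(1) by auto
    \<comment> \<open>\<open>k0\<close> makes the marked tail small; \<open>K\<close> puts the
      window above the levels where members \<open>l < K\<close> still copy their initial targets;
      \<open>n0\<close> puts it where target \<open>j\<close> is constant along edges.\<close>
    define k where "k = k0 + K + n0"
    have "(1 / 2 :: real) ^ k \<le> (1 / 2) ^ k0"
      by (rule power_decreasing) (simp_all add: k_def)
    then have k: "(1 / 2) ^ k < \<eta>"
      using k0 by (rule le_less_trans)
    obtain n where n: "n \<ge> k" "\<And>m. n < m \<Longrightarrow> m \<le> n + k \<Longrightarrow> \<tau> m = (i, j)"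
      using schedule[rule_format, of k "(i, j)"] by blast
    have "dist (omega adj x0 (n + k) ?f e) (\<phi> e) \<le> 2 * \<eta>" if e: "e \<in> bd - (Z \<union> marked_tail n k)" for e
    proof -
      define x where "x = vertex (n + k) e"
      have ebd: "e \<in> bd"
        using e by blast
      have lev_x: "lev x = n + k"
        using ebd by (simp add: x_def)
      \<comment> \<open>Comparing levels forces \<open>m = k\<close>, and then \<open>e\<close>
        would lie in the marked tail.\<close>
      have off: "x \<noteq> (c ^^ m) z" if "lev z = n" for m z
      proof
        assume x: "x = (c ^^ m) z"
        then have "m = k"
          using lev_x that by (simp add: lev_marked_power)
        then have "e \<in> B ((c ^^ k) z)"
          using x x_def lev_x ebd by (simp add: cylinder_iff)
        then show False
          using e that by (auto simp: marked_tail_def level_def)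
      qed
      have "ext (free_values \<delta> \<tau> l) x = (if l = i then \<delta> j x else 0)" if "l < K" for l
      proof (rule ext_eq_off_marked_paths[where n = n and N = "n + k"])
        show "free_values \<delta> \<tau> l y = (if l = i then \<delta> j y else 0)" if "n < lev y" "lev y \<le> n + k" for y
          using n that \<open>l < K\<close> by (auto simp: free_values_def k_def)
        show "(if l = i then \<delta> j z else 0) = (if l = i then \<delta> j y else 0)"
          if "n < lev y" "z \<in> S y" for y z
          using j(2)[of y z] that n(1) by (simp add: k_def)
      qed (use lev_x off g(1) in \<open>auto simp: k_def\<close>)
      then have "?f x = (\<Sum>l<K. if l = i then smul (a i) (\<delta> j x) else 0)"
        by (intro sum.cong) auto
      also have "\<dots> = smul (a i) (\<delta> j x)"
        using i(1) by simp
      finally have \<omega>: "omega adj x0 (n + k) ?f e = smul (a i) (\<delta> j x)"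
        by (simp add: omega_def x_def vertex_def)
      \<comment> \<open>This brings the value on the late level \<open>n + k\<close> back to level
        \<open>n0\<close>, where the target was matched with \<open>g\<close>.\<close>
      have along: "\<delta> j (vertex m e) = \<delta> j (vertex n0 e)" if "n0 \<le> m" for m
        using that
      proof (induction rule: dec_induct)
        case (step m)
        then show ?case
          using j(2)[OF _ vertex_Suc[OF ebd, of m]] ebd by simp
      qed simp
      have "\<delta> j x = \<delta> j (vertex n0 e)"
        unfolding x_def by (rule along) (simp add: k_def)
      with \<omega> have "omega adj x0 (n + k) ?f e = smul (a i) (\<delta> j (vertex n0 e))"
        by simp
      moreover have "dist (smul (a i) (\<delta> j (vertex n0 e))) (g (vertex n0 e)) < \<eta>"
        using ebd by (intro r(2) j(1)) simp
      moreover have "dist (g (vertex n0 e)) (\<phi> e) < \<eta>"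
        using e by (intro g(4)) simp
      ultimately show ?thesis
        using dist_triangle[of "smul (a i) (\<delta> j (vertex n0 e))" "\<phi> e" "g (vertex n0 e)"] by simp
    qed
    then have "L0_dist Pr (omega adj x0 (n + k) ?f) \<phi> \<le> 2 * \<eta> + prob (Z \<union> marked_tail n k)"
      using g(2) \<eta>(1) by (intro L0_dist_le) auto
    also have "\<dots> \<le> 2 * \<eta> + (prob Z + prob (marked_tail n k))"
      using g(2) by (intro add_left_mono measure_Un_le) auto
    also have "\<dots> < \<epsilon>"
      using g(3) k prob_marked_tail[of n k] \<eta>(2) by linarith
    finally show ?thesis
      using g(1) by (intro exI[of _ "n + k"]) (simp add: k_def)
  qed
  moreover have "?f \<in> H"
    by (intro harmonic_sum ext_harmonic)
  ultimately show ?thesis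
    unfolding universal_funs_def dense_in_L0_def using omega_measurable by fastforce
qed

text \<open>The constant \<open>u\<close> stays at a fixed positive distance from all images of the
  zero function. A nonzero \<open>u\<close> excludes the trivial space, in which zero is
  universal.\<close>

lemma zero_not_universal:
  assumes "(u::'e) \<noteq> 0"
  shows "(\<lambda>_. 0) \<notin> universal_funs adj x0 Pr smul w"
proof
  assume "(\<lambda>_. 0) \<in> universal_funs adj x0 Pr smul w"
  then have "dense_in_L0 Pr {omega adj x0 n (\<lambda>_. 0 :: 'e) |n. n \<ge> 1}"
    by (simp add: universal_funs_def)
  moreover have "(\<lambda>_. u) \<in> borel_measurable Pr"
    by simp
  moreover have "dist 0 u / (1 + dist 0 u) > 0"
    using assms by (intro divide_pos_pos add_pos_pos) auto
  ultimately obtain \<psi> where "\<psi> \<in> {omega adj x0 n (\<lambda>_. 0 :: 'e) |n. n \<ge> 1}"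
    "L0_dist Pr \<psi> (\<lambda>_. u) < dist 0 u / (1 + dist 0 u)"
    unfolding dense_in_L0_def by blast
  then show False
    using prob_space by (auto simp: L0_dist_def omega_def)
qed

section \<open>Spans of the even and the odd members\<close>

definition combinations :: "(nat \<Rightarrow> 'v \<Rightarrow> 'e) \<Rightarrow> (nat \<Rightarrow> bool) \<Rightarrow> ('v \<Rightarrow> 'e) set" where
  "combinations f Q = {\<lambda>x. \<Sum>l<K. smul (a l) (f l x) | K a. \<forall>l. a l \<noteq> 0 \<longrightarrow> l < K \<and> Q l}"

lemma combinationsI:
  assumes "\<And>l. a l \<noteq> 0 \<Longrightarrow> l < K \<and> Q l" "\<And>x. h x = (\<Sum>l<K. smul (a l) (f l x))"
  shows "h \<in> combinations f Q"
  unfolding combinations_def using assms by blast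

text \<open>Padding with zero coefficients allows every larger summation bound, so two combinations
  can share one index range.\<close>

lemma combinationsE:
  assumes "h \<in> combinations f Q"
  obtains K a where "\<And>l. a l \<noteq> 0 \<Longrightarrow> l < K \<and> Q l"
    "\<And>K' x. K \<le> K' \<Longrightarrow> h x = (\<Sum>l<K'. smul (a l) (f l x))"
proof -
  obtain K a where a: "\<And>l. a l \<noteq> 0 \<Longrightarrow> l < K \<and> Q l" "h = (\<lambda>x. \<Sum>l<K. smul (a l) (f l x))"
    using assms unfolding combinations_def by blast
  have "h x = (\<Sum>l<K'. smul (a l) (f l x))" if "K \<le> K'" for K' x
    unfolding a(2) using that a(1) by (intro sum.mono_neutral_left) fastforce+
  with a(1) that show ?thesis
    by blast
qed

lemma in_combinations:
  assumes "Q l"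
  shows "f l \<in> combinations f Q"
proof (rule combinationsI)
  show "f l x = (\<Sum>m<Suc l. smul (if m = l then 1 else 0) (f m x))" for x
    by (simp add: if_distrib[of "\<lambda>t. smul t _"] cong: if_cong)
qed (use assms in \<open>auto split: if_splits\<close>)

lemma subspace_combinations: "module.subspace (pointwise_smul smul) (combinations f Q)"
proof -
  interpret fn: module "pointwise_smul smul :: 'k \<Rightarrow> ('v \<Rightarrow> 'e) \<Rightarrow> 'v \<Rightarrow> 'e"
    by unfold_locales (auto simp: pointwise_smul_def fun_eq_iff scale_right_distrib scale_left_distrib)
  show ?thesis
  proof (rule fn.subspaceI)
    show "0 \<in> combinations f Q"
      by (rule combinationsI[of "\<lambda>_. 0" 0]) auto
  next
    fix g h assume "g \<in> combinations f Q" "h \<in> combinations f Q"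
    then obtain K a K' b where
      a: "\<And>l. a l \<noteq> 0 \<Longrightarrow> l < K \<and> Q l" "\<And>K' x. K \<le> K' \<Longrightarrow> g x = (\<Sum>l<K'. smul (a l) (f l x))" and
      b: "\<And>l. b l \<noteq> 0 \<Longrightarrow> l < K' \<and> Q l" "\<And>K x. K' \<le> K \<Longrightarrow> h x = (\<Sum>l<K. smul (b l) (f l x))"
      by (elim combinationsE) blast
    show "g + h \<in> combinations f Q"
    proof (rule combinationsI)
      show "l < max K K' \<and> Q l" if "a l + b l \<noteq> 0" for l
        using that a(1)[of l] b(1)[of l] by (cases "a l = 0") auto
      show "(g + h) x = (\<Sum>l<max K K'. smul (a l + b l) (f l x))" for x
        using a(2)[of "max K K'" x] b(2)[of "max K K'" x]
        by (simp add: scale_left_distrib sum.distrib)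
    qed
  next
    fix t h assume "h \<in> combinations f Q"
    then obtain K a where a: "\<And>l. a l \<noteq> 0 \<Longrightarrow> l < K \<and> Q l"
      "\<And>K' x. K \<le> K' \<Longrightarrow> h x = (\<Sum>l<K'. smul (a l) (f l x))"
      by (elim combinationsE) blast
    show "pointwise_smul smul t h \<in> combinations f Q"
    proof (rule combinationsI)
      show "pointwise_smul smul t h x = (\<Sum>l<K. smul (t * a l) (f l x))" for x
        using a(2)[of K x] by (simp add: pointwise_smul_def scale_sum_right)
    qed (use a(1) in auto)
  qed
qed

lemma ex_universal_subspaces:
  "\<exists>F1 F2. dense_subspace_of smul F1 H \<and> dense_subspace_of smul F2 H \<and>
     F1 \<subseteq> universal_funs adj x0 Pr smul w \<union> {0} \<and>
     F2 \<subseteq> universal_funs adj x0 Pr smul w \<union> {0} \<and> F1 \<inter> F2 = {0}"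
proof -
  obtain \<delta> where \<delta>: "rich_targets \<delta>"
    using ex_rich_targets ..
  obtain \<tau> :: "nat \<Rightarrow> nat \<times> nat"
    where \<tau>: "\<forall>p k. \<exists>n\<ge>k. \<forall>i. n < i \<and> i \<le> n + k \<longrightarrow> \<tau> i = p"
    using schedule_exists ..
  define f where "f l = ext (free_values \<delta> \<tau> l)" for l
  have universal: "(\<lambda>x. \<Sum>l<K. smul (a l) (f l x)) \<in> universal_funs adj x0 Pr smul w"
    if "a i \<noteq> 0" "i < K" for a i K
    unfolding f_def using universal_combination[OF \<delta> \<tau>, of i K a] that by blast
  have sub: "combinations f Q \<subseteq> universal_funs adj x0 Pr smul w \<union> {0}" for Q
  proof
    fix h assume "h \<in> combinations f Q"
    then obtain K a where a: "\<And>l. a l \<noteq> 0 \<Longrightarrow> l < K \<and> Q l"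
      "\<And>K' x. K \<le> K' \<Longrightarrow> h x = (\<Sum>l<K'. smul (a l) (f l x))"
      by (elim combinationsE) blast
    then have h: "h = (\<lambda>x. \<Sum>l<K. smul (a l) (f l x))"
      by auto
    show "h \<in> universal_funs adj x0 Pr smul w \<union> {0}"
    proof (cases "\<exists>i. a i \<noteq> 0")
      case True
      then show ?thesis
        using universal a(1) h by blast
    qed (simp add: h fun_eq_iff)
  qed
  have dense: "dense_subspace_of smul (combinations f Q) H"
    if Q: "\<And>j n. \<exists>l\<ge>n. Q l \<and> fst (prod_decode (l div 2)) = j" for Q
    unfolding dense_subspace_of_def
  proof (intro conjI)
    show "combinations f Q \<subseteq> H"
      unfolding combinations_def using harmonic_sum[of f] ext_harmonic by (auto simp: f_def)
    have "H \<subseteq> closure (f ` {l. Q l})"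
      unfolding f_def using \<delta> Q by (rule family_dense)
    also have "\<dots> \<subseteq> closure (combinations f Q)"
      by (intro closure_mono) (auto intro: in_combinations)
    finally show "H \<subseteq> closure (combinations f Q)" .
  qed (rule subspace_combinations)
  \<comment> \<open>The witness has parity \<open>b\<close>, and its half encodes
    \<open>(j, n)\<close>, which is at least \<open>n\<close>; so both parities meet every target
    index arbitrarily late.\<close>
  have index: "\<exists>l\<ge>n. l mod 2 = b \<and> fst (prod_decode (l div 2)) = j" if "b < 2" for j n b :: nat
    using that le_prod_encode_2[of n j] by (intro exI[of _ "2 * prod_encode (j, n) + b"]) simp
  have dense_even: "dense_subspace_of smul (combinations f even) H"
    using index[of 0] by (intro dense) (simp add: even_iff_mod_2_eq_zero)
  have dense_odd: "dense_subspace_of smul (combinations f odd) H"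
    using index[of 1] by (intro dense) (simp add: odd_iff_mod_2_eq_one)
  have "h = 0" if even: "h \<in> combinations f even" and odd: "h \<in> combinations f odd" for h
  proof (rule ccontr)
    assume "h \<noteq> 0"
    \<comment> \<open>This point serves twice: it forces a nonzero coefficient, and
      \<open>h x\<close> is the nonzero vector for \<open>zero_not_universal\<close>.\<close>
    then obtain x where "h x \<noteq> 0"
      by (auto simp: fun_eq_iff)
    obtain K a where a: "\<And>l. a l \<noteq> 0 \<Longrightarrow> l < K \<and> even l"
      "\<And>K' x. K \<le> K' \<Longrightarrow> h x = (\<Sum>l<K'. smul (a l) (f l x))"
      using even by (elim combinationsE) blast
    obtain K' b where b: "\<And>l. b l \<noteq> 0 \<Longrightarrow> l < K' \<and> odd l"
      "\<And>K x. K' \<le> K \<Longrightarrow> h x = (\<Sum>l<K. smul (b l) (f l x))"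
      using odd by (elim combinationsE) blast
    have "\<exists>i. a i \<noteq> 0"
    proof (rule ccontr)
      assume "\<nexists>i. a i \<noteq> 0"
      then show False
        using a(2)[of K x] \<open>h x \<noteq> 0\<close> by simp
    qed
    then obtain i where i: "a i \<noteq> 0"
      by blast
    then have "b i = 0"
      using a(1)[of i] b(1)[of i] by blast
    then have "a i - b i \<noteq> 0" "i < max K K'"
      using i a(1)[of i] by auto
    \<comment> \<open>The difference of the two representations of \<open>h\<close> is the zero
      function, yet its coefficient at \<open>i\<close> is nonzero.\<close>
    then have "(\<lambda>x. \<Sum>l<max K K'. smul (a l - b l) (f l x)) \<in> universal_funs adj x0 Pr smul w"
      by (rule universal)
    moreover have "(\<Sum>l<max K K'. smul (a l - b l) (f l x)) = 0" for x
      using a(2)[of "max K K'" x] b(2)[of "max K K'" x]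
      by (simp add: scale_left_diff_distrib sum_subtractf)
    ultimately show False
      using zero_not_universal[OF \<open>h x \<noteq> 0\<close>] by simp
  qed
  moreover have "0 \<in> combinations f Q" for Q
    by (rule combinationsI[of "\<lambda>_. 0" 0]) auto
  ultimately have "combinations f even \<inter> combinations f odd = {0}"
    by blast
  with dense_even dense_odd sub show ?thesis
    by (intro exI conjI)
qed

end

theorem theorem1p2:
  fixes adj :: "'v \<Rightarrow> 'v \<Rightarrow> bool" and x0 :: 'v
    and q :: "'v \<Rightarrow> 'v \<Rightarrow> real" and Pr :: "'v set measure"
    and smul :: "'k::{field, metric_space} \<Rightarrow> 'e::{ab_group_add, metric_space} \<Rightarrow> 'e"
    and w :: "'v \<Rightarrow> 'v \<Rightarrow> 'k"
  assumes "graph_tree adj"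
    and "\<And>n. finite (level adj x0 n)"
    and "\<And>x. card (children adj x0 x) \<ge> 2"
    and "\<And>x y. y \<in> children adj x0 x \<Longrightarrow> q x y > 0"
    and "\<And>x. (\<Sum>y\<in>children adj x0 x. q x y) = 1"
    and "boundary_measure adj x0 q Pr"
    and "continuous_field_ops TYPE('k)"
    and "metric_tvs smul"
    and "separable_space (euclidean :: 'e topology)"
    and "\<And>x y. y \<in> children adj x0 x \<Longrightarrow> w x y \<noteq> 0"
    and "\<And>x. (\<Sum>y\<in>children adj x0 x. w x y) = 1"
  shows "\<exists>F1 F2. dense_subspace_of smul F1 (harmonic_funs adj x0 smul w) \<and>
           dense_subspace_of smul F2 (harmonic_funs adj x0 smul w) \<and>
           F1 \<subseteq> universal_funs adj x0 Pr smul w \<union> {0} \<and>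
           F2 \<subseteq> universal_funs adj x0 Pr smul w \<union> {0} \<and>
           F1 \<inter> F2 = {0}"
proof -
  interpret rooted_tree adj x0
    using assms(1-3) by unfold_locales
  \<comment> \<open>At least two children share total probability 1, so they cannot all exceed
    1/2.\<close>
  have "\<exists>y\<in>S x. q x y \<le> 1 / 2" for x
  proof (rule ccontr)
    assume "\<not> (\<exists>y\<in>S x. q x y \<le> 1 / 2)"
    then have "(\<Sum>y\<in>S x. 1 / 2) < (\<Sum>y\<in>S x. q x y)"
      using assms(3)[of x] by (intro sum_strict_mono) (auto simp: not_le)
    then show False
      using assms(3)[of x] assms(5)[of x] by simp
  qed
  then obtain c where c: "\<And>x. c x \<in> S x" "\<And>x. q x (c x) \<le> 1 / 2"
    by metis
  interpret harmonic_boundary adj x0 c smul w q Pr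
    by unfold_locales (fact c assms)+
  show ?thesis
    by (rule ex_universal_subspaces)
qed

end
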